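(* Let $(P,\cdot,\circ)$ be a finite-dimensional dialgebra over a field $\mathbf{k}$ with $\operatorname{char}\mathbf{k}\neq 2$, and let $n=\dim P$. The following statements are equivalent: (a) $P$ is nilpotent; (b) if $B\neq P$ is a subalgebra of $P$, then there exists an element $x\in P$, $x\notin B$, such that $x\cdot y,\ y\cdot x,\ x\circ y,\ y\circ x\in B$ for all $y\in P$; (c) there is a basis $\{x_1,\dots,x_n\}$ of $P$ such that, for all $x\in P$, the matrices representing $P_x$, $P'_x$, $Q_x$ and $Q'_x$ with respect to this basis are all strictly upper triangular; (d) there is a chain of ideals of $P$ $$0=P_{(0)}\subset P_{(1)}\subset\cdots\subset P_{(n)}=P,$$ where $\dim P_{(i)}=i$ and $P\cdot P_{(i)}+P_{(i)}\cdot P+P_{(i)}\circ P+P\circ P_{(i)}\subseteq P_{(i-1)}$ for each $i=1,2,\dots,n$.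
   Context: A dialgebra $(P,\cdot,\circ)$ over $\mathbf{k}$ is a $\mathbf{k}$-vector space $P$ with two bilinear binary operations $\cdot$ and $\circ$ (no further identities are assumed). For subspaces $X,Y$ of $P$, $X\cdot Y$ (resp. $X\circ Y$) denotes the linear span of all $x\cdot y$ (resp. $x\circ y$), $x\in X$, $y\in Y$. A subalgebra is a linear subspace $A$ with $A\cdot A+A\circ A\subseteq A$. A subalgebra $I$ is an ideal if $I\cdot P+P\cdot I+I\circ P+P\circ I\subseteq I$. For $x\in P$ the linear endomorphisms $P_x,P'_x,Q_x,Q'_x$ of $P$ are defined by $P_x(y)=x\cdot y$, $P'_x(y)=y\cdot x$, $Q_x(y)=x\circ y$, $Q'_x(y)=y\circ x$. The matrix of an endomorphism $T$ with respect to $\{x_1,\dots,x_n\}$ has as $j$-th column the coordinates of $T(x_j)$. The lower central series is $P^1=P$, $P^n=\sum_{i=1}^{n-1}(P^i\cdot P^{n-i}+P^i\circ P^{n-i})$ for $n\ge 2$; $P$ is nilpotent if $P^m=0$ for some $m\ge 1$. *)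

theory Defs
  imports
    "HOL-Library.Set_Algebras"
    "HOL-Computational_Algebra.Computational_Algebra"
    "Jordan_Normal_Form.Matrix"
begin

text \<open>The underlying space is the whole type, so \<^term>\<open>UNIV\<close> plays the role of $P$. A sum of
  subspaces is the elementwise sum of sets from \<^theory>\<open>HOL-Library.Set_Algebras\<close>.\<close>

locale dialgebra = vector_space scale
  for scale :: "'k::field \<Rightarrow> 'p::ab_group_add \<Rightarrow> 'p" +
  fixes dot :: "'p \<Rightarrow> 'p \<Rightarrow> 'p" (infixl \<open>\<cdot>\<close> 70)
    and circ :: "'p \<Rightarrow> 'p \<Rightarrow> 'p" (infixl \<open>\<odot>\<close> 70)
  assumes linear_dot_right: "Vector_Spaces.linear scale scale (\<lambda>y. x \<cdot> y)"
    and linear_dot_left: "Vector_Spaces.linear scale scale (\<lambda>x. x \<cdot> y)"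
    and linear_circ_right: "Vector_Spaces.linear scale scale (\<lambda>y. x \<odot> y)"
    and linear_circ_left: "Vector_Spaces.linear scale scale (\<lambda>x. x \<odot> y)"
begin

definition span_prod :: "('p \<Rightarrow> 'p \<Rightarrow> 'p) \<Rightarrow> 'p set \<Rightarrow> 'p set \<Rightarrow> 'p set" where
  "span_prod f X Y = span {f x y | x y. x \<in> X \<and> y \<in> Y}"

definition subalgebra :: "'p set \<Rightarrow> bool" where
  "subalgebra A \<longleftrightarrow> subspace A \<and> span_prod (\<cdot>) A A + span_prod (\<odot>) A A \<subseteq> A"

definition ideal :: "'p set \<Rightarrow> bool" where
  "ideal I \<longleftrightarrow> subalgebra I \<and>
    span_prod (\<cdot>) I UNIV + span_prod (\<cdot>) UNIV I +
    span_prod (\<odot>) I UNIV + span_prod (\<odot>) UNIV I \<subseteq> I"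

text \<open>Indexed from 1 as usual; the value at 0 is a dummy.\<close>

function lower_central :: "nat \<Rightarrow> 'p set" where
  "lower_central n =
    (if n \<le> 1 then UNIV
     else \<Sum>i = 1..n - 1.
       span_prod (\<cdot>) (lower_central i) (lower_central (n - i)) +
       span_prod (\<odot>) (lower_central i) (lower_central (n - i)))"
  by auto
termination by (relation "measure id") auto

declare lower_central.simps [simp del]

definition nilpotent :: bool where
  "nilpotent \<longleftrightarrow> (\<exists>m\<ge>1. lower_central m = {0})"

end

context vector_space
begin

definition ordered_basis :: "'b list \<Rightarrow> bool" where
  "ordered_basis xs \<longleftrightarrow> distinct xs \<and> independent (set xs) \<and> span (set xs) = UNIV"

text \<open>Column $j$ holds the coordinates of the image of the $j$-th basis vector (indices from 0).\<close>

definition matrix_wrt :: "'b list \<Rightarrow> ('b \<Rightarrow> 'b) \<Rightarrow> 'a mat" where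
  "matrix_wrt xs T = mat (length xs) (length xs)
     (\<lambda>(i, j). representation (set xs) (T (xs ! j)) (xs ! i))"

end

definition strictly_upper_triangular :: "'a::zero mat \<Rightarrow> bool" where
  "strictly_upper_triangular A \<longleftrightarrow>
    (\<forall>i < dim_row A. \<forall>j < dim_col A. j \<le> i \<longrightarrow> A $$ (i, j) = 0)"

end

theory Submission
  imports Defs
begin

text \<open>(a) implies (b): the last term of the lower central series not contained in $B$ supplies $x$.
  (b) implies (d): applied to $B = P_{(i)}$, (b) supplies a vector that extends the chain by one
  dimension. (d) implies (a): of two indices with sum at least $2^{k+1}$ one is at least $2^k$, so
  inductively $P^m \subseteq P_{(n-k)}$ for $m \ge 2^k$. (c) and (d) correspond by letting $P_{(i)}$
  be the span of the first $i$ basis vectors.\<close>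

section \<open>Linear algebra: sums of sets and triangular matrices\<close>

lemma (in vector_space) set_plus_subset_iff:
  assumes "subspace Z" "0 \<in> A" "0 \<in> B"
  shows "A + B \<subseteq> Z \<longleftrightarrow> A \<subseteq> Z \<and> B \<subseteq> Z"
proof
  assume "A + B \<subseteq> Z"
  moreover have "A \<subseteq> A + B" "B \<subseteq> A + B"
    using assms(2,3) set_zero_plus2[of A B] set_zero_plus2[of B A] by (auto simp: add.commute)
  ultimately show "A \<subseteq> Z \<and> B \<subseteq> Z" by blast
next
  assume "A \<subseteq> Z \<and> B \<subseteq> Z"
  then show "A + B \<subseteq> Z"
    using assms(1) by (auto elim!: set_plus_elim intro: subspace_add)
qed

text \<open>Column \<open>j\<close> is strictly upper triangular when the coordinates of
  \<open>T (xs ! j)\<close> vanish from index \<open>j\<close> on, leaving a combination of the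
  earlier basis vectors. This makes condition (c) a statement about spans of initial
  segments.\<close>

lemma (in vector_space) strictly_upper_triangular_matrix_wrt_iff:
  assumes "ordered_basis xs"
  shows "strictly_upper_triangular (matrix_wrt xs T) \<longleftrightarrow>
    (\<forall>j<length xs. T (xs ! j) \<in> span (set (take j xs)))"
proof -
  have dist: "distinct xs" and ind: "independent (set xs)" and sp: "span (set xs) = UNIV"
    using assms by (auto simp: ordered_basis_def)
  have coords: "(\<forall>i<length xs. j \<le> i \<longrightarrow> representation (set xs) v (xs ! i) = 0) \<longleftrightarrow>
      v \<in> span (set (take j xs))" (is "?L \<longleftrightarrow> ?R") for j v
  proof
    assume L: ?L
    have "b \<in> set (take j xs)" if "representation (set xs) v b \<noteq> 0" for b
    proof -
      have "b \<in> set xs" using that by (rule representation_ne_zero)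
      then obtain i where i: "i < length xs" "b = xs ! i" by (auto simp: in_set_conv_nth)
      then have "i < j" using L that by (metis not_le)
      with i show ?thesis by (auto simp: in_set_conv_nth)
    qed
    \<comment> \<open>This sum is the expansion of \<open>v\<close> in the basis; its nonzero terms
      involve only the first \<open>j\<close> vectors.\<close>
    then have "(\<Sum>b | representation (set xs) v b \<noteq> 0. representation (set xs) v b *s b)
        \<in> span (set (take j xs))"
      by (intro span_sum span_scale span_base) auto
    then show ?R
      using sum_nonzero_representation_eq[OF ind] sp by simp
  next
    assume R: ?R
    \<comment> \<open>Coordinates of a vector in the span of a part of the basis can be computed in
      that part, so those outside it vanish.\<close>
    have "representation (set xs) v = representation (set (take j xs)) v"
      using R ind by (intro representation_extend) (auto dest: in_set_takeD)
    moreover have "xs ! i \<notin> set (take j xs)" if "i < length xs" "j \<le> i" for i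
      using that dist by (auto simp: in_set_conv_nth nth_eq_iff_index_eq)
    ultimately show ?L
      using representation_ne_zero by metis
  qed
  show ?thesis
    unfolding strictly_upper_triangular_def matrix_wrt_def using coords by auto
qed

section \<open>Absorption, subalgebras and ideals\<close>

context dialgebra
begin

text \<open>One predicate serves three purposes: \<open>absorbs {x} B\<close> is the property in
  (b), \<open>absorbs I I\<close> is the ideal property of a subspace, and
  \<open>absorbs (F (Suc i)) (F i)\<close> is the inclusion in (d).\<close>

definition absorbs :: "'p set \<Rightarrow> 'p set \<Rightarrow> bool" where
  "absorbs I J \<longleftrightarrow> (\<forall>x\<in>I. \<forall>y. x \<cdot> y \<in> J \<and> y \<cdot> x \<in> J \<and> x \<odot> y \<in> J \<and> y \<odot> x \<in> J)"

text \<open>For fixed \<open>y\<close> all four products are linear in the other factor, and a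
  linear map sends a span to the span of the image.\<close>

lemma absorbs_span:
  assumes "subspace J" "absorbs S J"
  shows "absorbs (span S) J"
  unfolding absorbs_def
proof (intro ballI allI)
  fix v y
  assume v: "v \<in> span S"
  have *: "T v \<in> J" if "Vector_Spaces.linear scale scale T" "T ` S \<subseteq> J" for T
  proof -
    interpret T: Vector_Spaces.linear scale scale T by fact
    have "T ` span S = span (T ` S)" by (simp add: T.span_image)
    also have "\<dots> \<subseteq> J" using that(2) assms(1) by (rule span_minimal)
    finally show ?thesis using v by blast
  qed
  show "v \<cdot> y \<in> J \<and> y \<cdot> v \<in> J \<and> v \<odot> y \<in> J \<and> y \<odot> v \<in> J"
    using assms(2) unfolding absorbs_def
    by (intro conjI *[OF linear_dot_left] *[OF linear_dot_right]
        *[OF linear_circ_left] *[OF linear_circ_right]) auto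
qed

lemma zero_in_span_prod: "0 \<in> span_prod f X Y"
  by (simp add: span_prod_def span_zero)

lemma zero_in_set_plus: "0 \<in> A \<Longrightarrow> 0 \<in> B \<Longrightarrow> 0 \<in> A + B" for A B :: "'p set"
  using set_plus_intro[of 0 A 0 B] by simp

lemma span_prod_subset_iff:
  assumes "subspace Z"
  shows "span_prod f X Y \<subseteq> Z \<longleftrightarrow> (\<forall>x\<in>X. \<forall>y\<in>Y. f x y \<in> Z)"
proof -
  have "span S \<subseteq> Z \<longleftrightarrow> S \<subseteq> Z" for S
    using span_superset[of S] span_minimal[OF _ assms, of S] by auto
  then show ?thesis unfolding span_prod_def by auto
qed

text \<open>As rewrite rules these reduce the inclusion of a sum of span products in a subspace to
  conditions on single products.\<close>

lemmas span_prod_sum_subset_iff =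
  set_plus_subset_iff span_prod_subset_iff zero_in_set_plus zero_in_span_prod

lemma subalgebra_iff:
  "subalgebra A \<longleftrightarrow> subspace A \<and> (\<forall>x\<in>A. \<forall>y\<in>A. x \<cdot> y \<in> A \<and> x \<odot> y \<in> A)"
  unfolding subalgebra_def by (simp add: span_prod_sum_subset_iff cong: conj_cong) blast

lemma ideal_iff: "ideal I \<longleftrightarrow> subspace I \<and> absorbs I I"
  unfolding ideal_def subalgebra_iff absorbs_def
  by (simp add: span_prod_sum_subset_iff cong: conj_cong) blast

section \<open>Lower central series\<close>

lemma lower_central_1: "lower_central (Suc 0) = UNIV"
  by (simp add: lower_central.simps)

lemma lower_central_prod:
  assumes "1 \<le> i" "1 \<le> j" "x \<in> lower_central i" "y \<in> lower_central j"
  shows "x \<cdot> y \<in> lower_central (i + j) \<and> x \<odot> y \<in> lower_central (i + j)"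
proof -
  let ?S = "\<lambda>l. span_prod (\<cdot>) (lower_central l) (lower_central (i + j - l)) +
       span_prod (\<odot>) (lower_central l) (lower_central (i + j - l))"
  have eq: "lower_central (i + j) = sum ?S {1..i + j - 1}"
    using assms(1,2) by (subst lower_central.simps) auto
  have prods: "x \<cdot> y \<in> span_prod (\<cdot>) (lower_central i) (lower_central (i + j - i))"
      "x \<odot> y \<in> span_prod (\<odot>) (lower_central i) (lower_central (i + j - i))"
    using assms by (auto simp: span_prod_def intro!: span_base)
  have "v \<in> lower_central (i + j)" if "v \<in> ?S i" for v
  proof -
    \<comment> \<open>An element of a sum of sets is a sum of chosen elements. Here \<open>v\<close>
      is chosen at index \<open>i\<close> and \<open>0\<close>, which lies in every summand,
      elsewhere.\<close>
    have "(\<Sum>l = 1..i + j - 1. if l = i then v else 0) \<in> lower_central (i + j)"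
      unfolding eq using that zero_in_set_plus[OF zero_in_span_prod zero_in_span_prod]
      by (subst set_sum_alt) (auto intro!: exI[of _ "\<lambda>l. if l = i then v else 0"])
    moreover have "i \<in> {1..i + j - 1}" using assms(1,2) by auto
    ultimately show ?thesis by (simp only: sum.delta finite_atLeastAtMost if_True)
  qed
  then show ?thesis
    using set_plus_intro[OF prods(1) zero_in_span_prod]
      set_plus_intro[OF zero_in_span_prod prods(2)] by simp
qed

text \<open>Counterpart of \<open>lower_central_prod\<close>: a subspace that contains all products
  of total index \<open>n\<close> contains each summand of the recursion, hence their sum.\<close>

lemma lower_central_subset:
  assumes "subspace Z" "2 \<le> n"
    and "\<And>i j x y. 1 \<le> i \<Longrightarrow> 1 \<le> j \<Longrightarrow> i + j = n \<Longrightarrow> x \<in> lower_central i \<Longrightarrow>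
      y \<in> lower_central j \<Longrightarrow> x \<cdot> y \<in> Z \<and> x \<odot> y \<in> Z"
  shows "lower_central n \<subseteq> Z"
proof -
  let ?S = "\<lambda>i. span_prod (\<cdot>) (lower_central i) (lower_central (n - i)) +
       span_prod (\<odot>) (lower_central i) (lower_central (n - i))"
  have "?S i \<subseteq> Z" if "i \<in> {1..n - 1}" for i
    using that assms(1) assms(3)[of i "n - i"] by (auto simp: span_prod_sum_subset_iff)
  then have "sum ?S {1..n - 1} \<subseteq> Z"
    using assms(1) by (subst set_sum_alt) (simp, blast intro: subspace_sum)
  moreover have "lower_central n = sum ?S {1..n - 1}"
    using assms(2) by (subst lower_central.simps) auto
  ultimately show ?thesis by simp
qed

text \<open>Nilpotency asks for equality with \<open>{0}\<close>, whereas the chain argument yields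
  only an inclusion.\<close>

lemma zero_in_lower_central: "0 \<in> lower_central n"
proof (cases "n \<le> 1")
  case False
  then show ?thesis
    by (subst lower_central.simps)
      (auto simp: set_sum_alt zero_in_set_plus zero_in_span_prod intro!: exI[of _ "\<lambda>_. 0"])
qed (simp add: lower_central.simps)

lemma nilpotent_imp_absorbed_outside:
  assumes "nilpotent" "0 \<in> B" "B \<noteq> UNIV"
  shows "\<exists>x. x \<notin> B \<and> absorbs {x} B"
proof -
  \<comment> \<open>Nilpotency supplies an index at least 1; writing it as a successor keeps the
    dummy index 0 out of the descent.\<close>
  obtain m where m: "lower_central (Suc m) = {0}"
    using assms(1) unfolding nilpotent_def by (metis Suc_pred' less_eq_Suc_le One_nat_def)
  \<comment> \<open>The series starts at the whole space, not inside \<open>B\<close>, and reaches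
    \<open>{0}\<close>, inside \<open>B\<close>, so two consecutive terms straddle this change.
    Otherwise non-inclusion would propagate up to index \<open>Suc m\<close>.\<close>
  have "\<exists>k<m. \<not> lower_central (Suc k) \<subseteq> B \<and> lower_central (Suc (Suc k)) \<subseteq> B"
  proof (rule ccontr)
    assume *: "\<not> ?thesis"
    have "k \<le> m \<Longrightarrow> \<not> lower_central (Suc k) \<subseteq> B" for k
    proof (induction k)
      case 0
      show ?case using assms(3) by (auto simp: lower_central_1)
    next
      case (Suc k)
      then show ?case using * by (metis Suc_le_eq less_imp_le)
    qed
    then show False using m assms(2) by fastforce
  qed
  then obtain k x where k: "lower_central (Suc (Suc k)) \<subseteq> B"
    and x: "x \<in> lower_central (Suc k)" "x \<notin> B" by blast
  \<comment> \<open>Multiplying by an arbitrary \<open>y\<close> thus raises the index of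
    \<open>x\<close> by one, into the term contained in \<open>B\<close>.\<close>
  have "y \<in> lower_central 1" for y by (simp add: lower_central_1)
  then have "absorbs {x} B"
    unfolding absorbs_def
    using k lower_central_prod[of "Suc k" 1 x] lower_central_prod[of 1 "Suc k" _ x] x by auto
  with x show ?thesis by blast
qed

text \<open>Absorption needs only one factor in \<open>F (n - k)\<close>, the other being arbitrary.
  The index \<open>m\<close> is generalized because the induction hypothesis is applied to the index
  of that one factor.\<close>

lemma lower_central_subset_chain:
  assumes "\<And>i. i \<le> n \<Longrightarrow> subspace (F i)" "F n = UNIV"
    and "\<And>i. i < n \<Longrightarrow> absorbs (F (Suc i)) (F i)"
  shows "k \<le> n \<Longrightarrow> 2 ^ k \<le> m \<Longrightarrow> lower_central m \<subseteq> F (n - k)"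
proof (induction k arbitrary: m)
  case (Suc k)
  have absorbs: "absorbs (F (n - k)) (F (n - Suc k))"
    using assms(3)[of "n - Suc k"] Suc.prems(1) by (simp add: Suc_diff_Suc)
  show ?case
  proof (rule lower_central_subset)
    have "(1::nat) \<le> 2 ^ k" by simp
    then show "2 \<le> m" using Suc.prems(2) unfolding power_Suc by linarith
  next
    fix i j x y
    assume ij: "i + j = m" and xy: "x \<in> lower_central i" "y \<in> lower_central j"
    have "2 ^ k \<le> i \<or> 2 ^ k \<le> j" using ij Suc.prems(2) by auto
    then have "x \<in> F (n - k) \<or> y \<in> F (n - k)" using xy Suc.IH Suc.prems(1) by auto
    then show "x \<cdot> y \<in> F (n - Suc k) \<and> x \<odot> y \<in> F (n - Suc k)"
      using absorbs unfolding absorbs_def by blast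
  qed (simp add: assms(1))
qed (simp add: assms(2))

section \<open>Chains of ideals\<close>

text \<open>The chain of (d) with variable length \<open>m\<close>, so that it can be built by
  induction. That the members are ideals and that a chain of full length ends at the whole space is
  derived afterwards.\<close>

definition absorbing_chain :: "nat \<Rightarrow> (nat \<Rightarrow> 'p set) \<Rightarrow> bool" where
  "absorbing_chain m F \<longleftrightarrow> F 0 = {0} \<and> (\<forall>i\<le>m. subspace (F i) \<and> dim (F i) = i) \<and>
    (\<forall>i<m. F i \<subseteq> F (Suc i) \<and> absorbs (F (Suc i)) (F i))"

lemma nilpotent_if_absorbing_chain:
  assumes "absorbing_chain n F" "F n = UNIV"
  shows nilpotent
proof -
  have "lower_central (2 ^ n) \<subseteq> {0}"
    using lower_central_subset_chain[of n F n "2 ^ n"] assms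
    unfolding absorbing_chain_def by auto
  then show ?thesis
    unfolding nilpotent_def using zero_in_lower_central by (intro exI[of _ "2 ^ n"]) auto
qed

text \<open>Products with \<open>F (Suc j)\<close> fall into \<open>F j\<close>, which is contained
  in \<open>F (Suc j)\<close>. The bottom member has no predecessor and is treated as the span of
  the empty set.\<close>

lemma absorbing_chain_imp_ideal:
  assumes "absorbing_chain m F" "i \<le> m"
  shows "ideal (F i)"
proof (cases i)
  case 0
  have "absorbs (span {}) {0}" by (rule absorbs_span) (auto simp: absorbs_def)
  with 0 assms show ?thesis by (simp add: ideal_iff absorbing_chain_def)
next
  case (Suc j)
  with assms have "subspace (F i)" "F j \<subseteq> F i" "absorbs (F i) (F j)"
    by (auto simp: absorbing_chain_def)
  then show ?thesis by (auto simp: ideal_iff absorbs_def)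
qed

lemma ideal_chain_iff:
  "(F 0 = {0} \<and> F n = UNIV \<and> (\<forall>i\<le>n. ideal (F i) \<and> dim (F i) = i) \<and>
      (\<forall>i\<in>{1..n}. F (i - 1) \<subset> F i \<and>
         span_prod (\<cdot>) UNIV (F i) + span_prod (\<cdot>) (F i) UNIV +
         span_prod (\<odot>) (F i) UNIV + span_prod (\<odot>) UNIV (F i) \<subseteq> F (i - 1))) \<longleftrightarrow>
    absorbing_chain n F \<and> F n = UNIV" (is "?L \<longleftrightarrow> ?R")
proof -
  have step: "span_prod (\<cdot>) UNIV (F (Suc i)) + span_prod (\<cdot>) (F (Suc i)) UNIV +
      span_prod (\<odot>) (F (Suc i)) UNIV + span_prod (\<odot>) UNIV (F (Suc i)) \<subseteq> F i
      \<longleftrightarrow> absorbs (F (Suc i)) (F i)" if "subspace (F i)" for i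
    using that by (simp add: span_prod_sum_subset_iff absorbs_def) blast
  \<comment> \<open>Passing to successors removes the truncated subtraction in
    \<open>F (i - 1)\<close>.\<close>
  have reindex: "(\<forall>i\<in>{1..n}. Q i) \<longleftrightarrow> (\<forall>i<n. Q (Suc i))" for Q
    unfolding image_Suc_lessThan[symmetric] by auto
  show ?thesis
  proof
    assume ?L
    then have "subspace (F i)" if "i \<le> n" for i using that by (simp add: ideal_iff)
    with \<open>?L\<close> show ?R
      unfolding absorbing_chain_def reindex by (auto simp: step)
  next
    assume R: ?R
    \<comment> \<open>The dimensions \<open>i\<close> and \<open>Suc i\<close> differ, which makes
      the inclusions strict.\<close>
    then have "F i \<noteq> F (Suc i)" if "i < n" for i
      using that unfolding absorbing_chain_def by (metis Suc_leI less_imp_le n_not_Suc_n)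
    with R show ?L
      unfolding reindex using absorbing_chain_imp_ideal[of n F]
      by (auto simp: step absorbing_chain_def)
  qed
qed

end

section \<open>Chains and adapted bases in finite dimension\<close>

locale finite_dimensional_dialgebra =
  dialgebra scale dot circ + finite_dimensional_vector_space scale Basis
  for scale :: "'k::field \<Rightarrow> 'p::ab_group_add \<Rightarrow> 'p"
    and dot (infixl \<open>\<cdot>\<close> 70) and circ (infixl \<open>\<odot>\<close> 70) and Basis
begin

lemma absorbing_chain_UNIV:
  assumes "absorbing_chain (dim UNIV) F"
  shows "F (dim UNIV) = UNIV"
proof -
  have "span (F (dim UNIV)) = span UNIV"
    using assms by (intro dim_eq_span) (auto simp: absorbing_chain_def)
  moreover have "subspace (F (dim UNIV))" using assms by (simp add: absorbing_chain_def)
  ultimately show ?thesis by (metis span_UNIV span_eq_iff)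
qed

lemma absorbing_chain_exists:
  assumes "\<And>B. subalgebra B \<Longrightarrow> B \<noteq> UNIV \<Longrightarrow> \<exists>x. x \<notin> B \<and> absorbs {x} B"
  shows "m \<le> dim UNIV \<Longrightarrow> \<exists>F. absorbing_chain m F"
proof (induction m)
  case 0
  show ?case by (rule exI[of _ "\<lambda>_. {0}"]) (auto simp: absorbing_chain_def)
next
  case (Suc m)
  then obtain F where F: "absorbing_chain m F" by auto
  then have sub: "subspace (F m)" and dim: "dim (F m) = m" and "ideal (F m)"
    using absorbing_chain_imp_ideal by (auto simp: absorbing_chain_def)
  \<comment> \<open>\<open>F m\<close> is a proper subalgebra, since it is an ideal of dimension
    \<open>m\<close>, less than \<open>dim UNIV\<close>.\<close>
  then obtain x where x: "x \<notin> F m" "absorbs {x} (F m)"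
    using assms[of "F m"] Suc.prems by (force simp: ideal_def)
  define F' where "F' = F(Suc m := span (insert x (F m)))"
  \<comment> \<open>Products with \<open>x\<close> lie in \<open>F m\<close> by choice of
    \<open>x\<close>, and products with elements of \<open>F m\<close> do so because
    \<open>F m\<close> is an ideal.\<close>
  have "absorbs (insert x (F m)) (F m)"
    using x(2) \<open>ideal (F m)\<close> by (auto simp: ideal_iff absorbs_def)
  then have "absorbs (span (insert x (F m))) (F m)" using sub by (rule absorbs_span[rotated])
  moreover have "dim (span (insert x (F m))) = Suc m"
    using x(1) dim sub by (metis dim_insert dim_span span_eq_iff Suc_eq_plus1)
  ultimately have "absorbing_chain (Suc m) F'"
    using F unfolding F'_def absorbing_chain_def
    by (auto simp: less_Suc_eq le_Suc_eq intro: span_base)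
  then show ?case by blast
qed

text \<open>A basis of \<open>F m\<close> is extended by any vector of \<open>F (Suc m)\<close>
  outside \<open>F m\<close>; comparing dimensions shows that the enlarged list spans
  \<open>F (Suc m)\<close>.\<close>

lemma adapted_basis_exists:
  assumes F: "absorbing_chain n F"
  shows "m \<le> n \<Longrightarrow> \<exists>xs. length xs = m \<and> distinct xs \<and> independent (set xs) \<and>
    (\<forall>j\<le>m. span (set (take j xs)) = F j)"
proof (induction m)
  case 0
  show ?case using F by (auto simp: absorbing_chain_def independent_empty)
next
  case (Suc m)
  then obtain xs where xs: "length xs = m" "distinct xs" "independent (set xs)"
    "\<And>j. j \<le> m \<Longrightarrow> span (set (take j xs)) = F j" by auto
  from xs(1) xs(4)[of m] have span: "span (set xs) = F m" by simp
  have sub: "subspace (F (Suc m))" and dim: "dim (F m) = m" "dim (F (Suc m)) = Suc m"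
    and le: "F m \<subseteq> F (Suc m)"
    using F Suc.prems by (auto simp: absorbing_chain_def)
  then have "F m \<noteq> F (Suc m)" by auto
  with le obtain x where x: "x \<in> F (Suc m)" "x \<notin> F m" by blast
  have "set xs \<subseteq> F m" using span span_base by blast
  then have incl: "insert x (set xs) \<subseteq> F (Suc m)" using le x(1) by auto
  have "dim (insert x (set xs)) = Suc m"
    using x(2) span dim(1) by (metis dim_insert dim_span Suc_eq_plus1)
  then have "span (insert x (set xs)) = span (F (Suc m))"
    using incl dim(2) by (intro dim_eq_span) auto
  then have "span (insert x (set xs)) = F (Suc m)" using sub by simp
  moreover have "x \<notin> set xs" using x(2) \<open>set xs \<subseteq> F m\<close> by auto
  moreover have "independent (insert x (set xs))"
    using xs(3) x(2) span by (simp add: independent_insertI)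
  ultimately show ?case
    using xs by (intro exI[of _ "xs @ [x]"]) (auto simp: le_Suc_eq)
qed

lemma absorbing_chain_span_take:
  assumes "ordered_basis xs"
    and "\<And>j. j < length xs \<Longrightarrow> absorbs {xs ! j} (span (set (take j xs)))"
  shows "absorbing_chain (length xs) (\<lambda>i. span (set (take i xs)))"
  unfolding absorbing_chain_def
proof (intro conjI allI impI)
  fix i assume "i \<le> length xs"
  moreover have "independent (set (take i xs))"
    using assms(1) set_take_subset unfolding ordered_basis_def by (metis independent_mono)
  ultimately show "dim (span (set (take i xs))) = i"
    using assms(1)
    by (simp add: dim_eq_card_independent distinct_card ordered_basis_def)
next
  fix i assume i: "i < length xs"
  show "span (set (take i xs)) \<subseteq> span (set (take (Suc i) xs))"
    by (intro span_mono set_take_subset_set_take) simp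
  \<comment> \<open>Each of the first \<open>i + 1\<close> basis vectors is absorbed by the span of
    its own predecessors, which lies in the span of the first \<open>i\<close> vectors.\<close>
  have "absorbs {xs ! j} (span (set (take i xs)))" if "j \<le> i" for j
  proof -
    have "span (set (take j xs)) \<subseteq> span (set (take i xs))"
      using that by (intro span_mono set_take_subset_set_take)
    then show ?thesis using assms(2)[of j] that i unfolding absorbs_def by auto
  qed
  then have "absorbs (set (take (Suc i) xs)) (span (set (take i xs)))"
    using i by (auto simp: absorbs_def in_set_conv_nth less_Suc_eq_le)
  then show "absorbs (span (set (take (Suc i) xs))) (span (set (take i xs)))"
    by (intro absorbs_span) simp
qed auto

text \<open>The left side stands for (d), the right side for (c) read column by column. One passes
  from chain to basis by an adapted basis and back by spans of initial segments.\<close>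

lemma absorbing_chain_iff_triangular_basis:
  "(\<exists>F. absorbing_chain (dim UNIV) F) \<longleftrightarrow>
    (\<exists>xs. length xs = dim UNIV \<and> ordered_basis xs \<and>
      (\<forall>j<length xs. absorbs {xs ! j} (span (set (take j xs)))))"
proof
  assume "\<exists>F. absorbing_chain (dim UNIV) F"
  then obtain F where F: "absorbing_chain (dim UNIV) F" by blast
  then obtain xs where xs: "length xs = dim UNIV" "distinct xs" "independent (set xs)"
    "\<And>j. j \<le> dim UNIV \<Longrightarrow> span (set (take j xs)) = F j"
    using adapted_basis_exists[OF F, of "dim UNIV"] by blast
  have "absorbs {xs ! j} (span (set (take j xs)))" if "j < length xs" for j
  proof -
    have "xs ! j \<in> span (set (take (Suc j) xs))"
      using that by (intro span_base) (auto simp: take_Suc_conv_app_nth)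
    then have "xs ! j \<in> F (Suc j)" using xs(1,4) that by simp
    then show ?thesis
      using F xs(1,4) that by (simp add: absorbing_chain_def absorbs_def)
  qed
  moreover have "span (set xs) = UNIV"
    using xs(4)[of "dim UNIV"] xs(1) absorbing_chain_UNIV[OF F] by simp
  ultimately show "\<exists>xs. length xs = dim UNIV \<and> ordered_basis xs \<and>
      (\<forall>j<length xs. absorbs {xs ! j} (span (set (take j xs))))"
    using xs by (auto simp: ordered_basis_def)
qed (metis absorbing_chain_span_take)

end

theorem proposition2p2:
  fixes scale :: "'k::field \<Rightarrow> 'p::ab_group_add \<Rightarrow> 'p"
    and dot :: "'p \<Rightarrow> 'p \<Rightarrow> 'p" (infixl \<open>\<cdot>\<close> 70)
    and circ :: "'p \<Rightarrow> 'p \<Rightarrow> 'p" (infixl \<open>\<odot>\<close> 70)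
    and n :: nat
  assumes "dialgebra scale (\<cdot>) (\<odot>)"
    and "\<exists>Basis. finite_dimensional_vector_space scale Basis"
    and "CHAR('k) \<noteq> 2"
    and "n = vector_space.dim scale (UNIV :: 'p set)"
  defines "a \<equiv> dialgebra.nilpotent scale (\<cdot>) (\<odot>)"
    and "b \<equiv> \<forall>B. dialgebra.subalgebra scale (\<cdot>) (\<odot>) B \<and> B \<noteq> UNIV \<longrightarrow>
      (\<exists>x. x \<notin> B \<and> (\<forall>y. x \<cdot> y \<in> B \<and> y \<cdot> x \<in> B \<and> x \<odot> y \<in> B \<and> y \<odot> x \<in> B))"
    and "c \<equiv> \<exists>xs. length xs = n \<and> vector_space.ordered_basis scale xs \<and>
      (\<forall>x. strictly_upper_triangular (vector_space.matrix_wrt scale xs (\<lambda>y. x \<cdot> y)) \<and>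
           strictly_upper_triangular (vector_space.matrix_wrt scale xs (\<lambda>y. y \<cdot> x)) \<and>
           strictly_upper_triangular (vector_space.matrix_wrt scale xs (\<lambda>y. x \<odot> y)) \<and>
           strictly_upper_triangular (vector_space.matrix_wrt scale xs (\<lambda>y. y \<odot> x)))"
    and "d \<equiv> \<exists>F :: nat \<Rightarrow> 'p set. F 0 = {0} \<and> F n = UNIV \<and>
      (\<forall>i\<le>n. dialgebra.ideal scale (\<cdot>) (\<odot>) (F i) \<and> vector_space.dim scale (F i) = i) \<and>
      (\<forall>i\<in>{1..n}. F (i - 1) \<subset> F i \<and>
         dialgebra.span_prod scale (\<cdot>) UNIV (F i) + dialgebra.span_prod scale (\<cdot>) (F i) UNIV +
         dialgebra.span_prod scale (\<odot>) (F i) UNIV + dialgebra.span_prod scale (\<odot>) UNIV (F i)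
           \<subseteq> F (i - 1))"
  shows "(a \<longleftrightarrow> b) \<and> (b \<longleftrightarrow> c) \<and> (c \<longleftrightarrow> d)"
proof -
  from assms(2) obtain Basis where "finite_dimensional_vector_space scale Basis" by blast
  then interpret finite_dimensional_dialgebra scale dot circ Basis
    using assms(1) by (simp add: finite_dimensional_dialgebra_def)
  note n = \<open>n = dim UNIV\<close>
  have b: "b \<longleftrightarrow> (\<forall>B. subalgebra B \<and> B \<noteq> UNIV \<longrightarrow> (\<exists>x. x \<notin> B \<and> absorbs {x} B))"
    unfolding b_def absorbs_def by simp
  have d: "d \<longleftrightarrow> (\<exists>F. absorbing_chain n F)"
    unfolding d_def ideal_chain_iff n using absorbing_chain_UNIV by blast
  have c: "c \<longleftrightarrow> (\<exists>xs. length xs = n \<and> ordered_basis xs \<and>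
      (\<forall>j<length xs. absorbs {xs ! j} (span (set (take j xs)))))"
    \<comment> \<open>Triangularity of the four matrices for every \<open>x\<close> concerns the
      products of \<open>xs ! j\<close> with every \<open>x\<close>, so exchanging the quantifiers
      over \<open>x\<close> and \<open>j\<close> gives absorption.\<close>
    unfolding c_def absorbs_def
    by (intro ex_cong1 conj_cong refl) (auto simp: strictly_upper_triangular_matrix_wrt_iff)
  have "a \<Longrightarrow> b"
    unfolding a_def b using nilpotent_imp_absorbed_outside subspace_0
    by (auto simp: subalgebra_iff)
  moreover have "b \<Longrightarrow> d"
    unfolding b d n by (rule absorbing_chain_exists) auto
  moreover have "d \<Longrightarrow> a"
    unfolding a_def d n using nilpotent_if_absorbing_chain absorbing_chain_UNIV by blast
  moreover have "c \<longleftrightarrow> d"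
    unfolding c d n by (rule absorbing_chain_iff_triangular_basis[symmetric])
  ultimately show ?thesis by blast
qed

end
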